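(* Let $x(t,\theta)\in\mathbb{R}^n$, $\theta\in\mathbb{R}^p$, be the trajectory of a hybrid system flowing in mode $q$ according to $\dot x=f_q(x,\theta)$ up to an event. Suppose the event time $\tau(\theta)$ is defined implicitly by a guard condition $$g\big(x(\tau(\theta),\theta),\theta,\tau(\theta)\big)=0,$$ where $g:\mathbb{R}^n\times\mathbb{R}^p\times\mathbb{R}\to\mathbb{R}$, $(x,\theta,t)\mapsto g(x,\theta,t)$, is continuously differentiable. If $$D_tg(\tau^-)+D_xg(\tau^-)\,f_q^-(\tau^-)\neq0,$$ then the derivative of the switching time with respect to $\theta$ is $$\frac{\partial\tau}{\partial\theta}=-\frac{D_xg(\tau^-)\,Z(\tau^-)+D_\theta g(\tau^-)}{D_tg(\tau^-)+D_xg(\tau^-)\,f_q^-(\tau^-)} .$$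
   Context: Notation: $D_x,D_\theta,D_t$ denote partial derivatives of $g$ with respect to its state, parameter and time arguments ($D_xg$ and $D_\theta g$ are row vectors, and $\partial\tau/\partial\theta$ is a row vector in $\mathbb{R}^{1\times p}$). The argument $(\tau^-)$ means evaluation immediately before the event, i.e. at time $\tau(\theta)$ and at the pre-event state $x(\tau(\theta)^-,\theta)$; $f_q^-(\tau^-)$ is the pre-event vector field $f_q$ evaluated there. $Z(t)=\partial x(t,\theta)/\partial\theta\in\mathbb{R}^{n\times p}$ is the sensitivity of the pre-event flow with respect to $\theta$ at fixed $t$, and $Z(\tau^-)$ is its value immediately before the event. Standing assumptions: the vector field $f_q$ is continuously differentiable, so that the mode-$q$ flow $x(t,\theta)$ (continued in mode $q$ slightly past the event) is continuously differentiable in $(t,\theta)$ near $(\tau(\theta),\theta)$; the event time $\tau(\cdot)$ is the locally defined continuous solution branch of the guard condition near the parameter value under consideration. *)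

theory Defs
  imports "HOL-Analysis.Analysis"
begin

definition cont_diff_on ::
  "('a::real_normed_vector \<Rightarrow> 'b::real_normed_vector) \<Rightarrow> 'a set \<Rightarrow> bool"
  where "cont_diff_on F S \<longleftrightarrow>
    (\<exists>F' :: 'a \<Rightarrow> 'a \<Rightarrow>\<^sub>L 'b.
      (\<forall>z\<in>S. (F has_derivative blinfun_apply (F' z)) (at z)) \<and> continuous_on S F')"

(* Row vectors in R^(1 x m) are represented by elements of real^'m.  For rows r, the product
   of r with a column v is the inner product of r and v, and the product with a matrix M
   is r v* M. *)
definition row_deriv :: "(real^'m \<Rightarrow> real) \<Rightarrow> real^'m \<Rightarrow> real^'m"
  where "row_deriv h u = (\<chi> i. frechet_derivative h (at u) (axis i 1))"

definition D_x :: "(real^'n \<Rightarrow> real^'p \<Rightarrow> real \<Rightarrow> real) \<Rightarrow> real^'n \<Rightarrow> real^'p \<Rightarrow> real \<Rightarrow> real^'n"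
  where "D_x g x \<theta> t = row_deriv (\<lambda>y. g y \<theta> t) x"

definition D_theta :: "(real^'n \<Rightarrow> real^'p \<Rightarrow> real \<Rightarrow> real) \<Rightarrow> real^'n \<Rightarrow> real^'p \<Rightarrow> real \<Rightarrow> real^'p"
  where "D_theta g x \<theta> t = row_deriv (\<lambda>\<eta>. g x \<eta> t) \<theta>"

definition D_t :: "(real^'n \<Rightarrow> real^'p \<Rightarrow> real \<Rightarrow> real) \<Rightarrow> real^'n \<Rightarrow> real^'p \<Rightarrow> real \<Rightarrow> real"
  where "D_t g x \<theta> t = deriv (\<lambda>s. g x \<theta> s) t"

(* Value immediately before time t.  As Lim is a definite description, this is meaningful
   only where the left limit exists. *)
definition before :: "(real \<Rightarrow> 'a::t2_space) \<Rightarrow> real \<Rightarrow> 'a"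
  where "before h t = Lim (at_left t) h"

definition sensitivity :: "(real \<Rightarrow> real^'p \<Rightarrow> real^'n) \<Rightarrow> real^'p \<Rightarrow> real \<Rightarrow> real^'p^'n"
  where "sensitivity \<phi> \<theta> t = jacobian (\<phi> t) (at \<theta>)"

(* The trajectory x enters mode q at time s eta and leaves it at the event time tau eta.
   Its values at and after the event, where the state may be reset, are unconstrained. *)
definition mode_trajectory ::
  "(real^'n \<Rightarrow> real^'p \<Rightarrow> real^'n) \<Rightarrow> (real \<Rightarrow> real^'p \<Rightarrow> real^'n) \<Rightarrow> (real^'p \<Rightarrow> real) \<Rightarrow>
   (real^'p \<Rightarrow> real) \<Rightarrow> (real^'p) set \<Rightarrow> bool"
  where "mode_trajectory f x s \<tau> U \<longleftrightarrow>
    (\<forall>\<eta>\<in>U. s \<eta> < \<tau> \<eta> \<and>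
      (\<forall>t. s \<eta> < t \<and> t < \<tau> \<eta> \<longrightarrow>
        ((\<lambda>r. x r \<eta>) has_vector_derivative f (x t \<eta>) \<eta>) (at t)))"

(* phi is the mode-q flow near the event: it agrees with x before the event, and also
   solves the mode-q equation at and past it. *)
definition continued_flow ::
  "(real^'n \<Rightarrow> real^'p \<Rightarrow> real^'n) \<Rightarrow> (real \<Rightarrow> real^'p \<Rightarrow> real^'n) \<Rightarrow> (real^'p \<Rightarrow> real) \<Rightarrow>
   (real^'p \<Rightarrow> real) \<Rightarrow> (real^'p) set \<Rightarrow>
   (real \<Rightarrow> real^'p \<Rightarrow> real^'n) \<Rightarrow> (real \<times> (real^'p)) set \<Rightarrow> bool"
  where "continued_flow f x s \<tau> U \<phi> N \<longleftrightarrow>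
    (\<forall>(t, \<eta>)\<in>N. ((\<lambda>r. \<phi> r \<eta>) has_vector_derivative f (\<phi> t \<eta>) \<eta>) (at t)) \<and>
    (\<forall>(t, \<eta>)\<in>N. \<eta> \<in> U \<and> s \<eta> < t \<and> t < \<tau> \<eta> \<longrightarrow> \<phi> t \<eta> = x t \<eta>)"

end

(* Before the event the trajectory coincides with the continued flow phi, so the guard says that
   G (t, eta) = g (phi t eta) eta t vanishes along t = tau eta.  The time derivative of G at the
   event is D_t g + D_x g . f, which is nonzero, and its parameter derivative is
   D_x g Z + D_theta g.  As tau is a continuous branch of G = 0, the first-order expansion of G at
   the event first makes tau Lipschitz at theta and then yields its derivative; the implicit
   function theorem is not needed. *)
theory Submission
  imports Defs
begin

text \<open>With \<open>a\<close> and \<open>h\<close> the increments of \<open>\<tau>\<close> and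
  of the parameter, the expansion of \<open>G\<close> bounds \<open>|a c + A h|\<close> by
  \<open>d (|a| + |h|)\<close> for any \<open>d > 0\<close>. If \<open>d\<close> is at most
  \<open>|c| / 2\<close>, the term in \<open>|a|\<close> is absorbed on the left, so
  \<open>|a| \<le> M |h|\<close>. Inserting this makes the remainder \<open>O(d |h|)\<close>, and
  division by \<open>c\<close> finishes.\<close>

lemma has_derivative_implicit_scalar:
  fixes G :: "real \<times> 'a::real_normed_vector \<Rightarrow> real"
  assumes G: "(G has_derivative G') (at (\<tau> \<theta>, \<theta>))"
    and nz: "G' (1, 0) \<noteq> 0"
    and cont: "isCont \<tau> \<theta>"
    and zero: "\<forall>\<^sub>F \<eta> in nhds \<theta>. G (\<tau> \<eta>, \<eta>) = 0"
  shows "(\<tau> has_derivative (\<lambda>h. - (G' (0, h) / G' (1, 0)))) (at \<theta>)"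
proof -
  define c where "c = G' (1, 0)"
  define A where "A h = G' (0, h)" for h
  have c: "\<bar>c\<bar> > 0" using nz by (simp add: c_def)
  have blG: "bounded_linear G'" using G by (rule has_derivative_bounded_linear)
  interpret G': bounded_linear G' by (rule blG)
  have split: "G' (a, h) = a * c + A h" for a h
  proof -
    have "G' (a *\<^sub>R (1, 0) + (0, h)) = a * c + A h"
      unfolding G'.add G'.scaleR c_def A_def by simp
    then show ?thesis by simp
  qed
  have "bounded_linear (\<lambda>h::'a. (0::real, h))"
    by (intro bounded_linear_Pair bounded_linear_zero bounded_linear_ident)
  then have blA: "bounded_linear A"
    unfolding A_def using bounded_linear_compose[OF blG] by blast
  obtain K where K: "K > 0" "\<And>h. \<bar>A h\<bar> \<le> K * norm h"
    using bounded_linear.pos_bounded[OF blA] by (auto simp: mult.commute)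
  \<comment> \<open>\<open>M\<close> comes from solving
    \<open>|a| |c| \<le> |c| / 2 * (|a| + |h|) + K |h|\<close> for \<open>|a|\<close>.\<close>
  define M where "M = 2 * K / \<bar>c\<bar> + 1"
  have M: "M > 0" using K c by (simp add: M_def add_pos_pos)
  have zero_at: "G (\<tau> \<theta>, \<theta>) = 0" using eventually_nhds_x_imp_x[OF zero] .
  have zero_near: "\<forall>\<^sub>F \<eta> in at \<theta>. G (\<tau> \<eta>, \<eta>) = 0"
    using zero by (simp add: eventually_at_filter eventually_mono)
  have "((\<lambda>\<eta>. (\<tau> \<eta>, \<eta>)) \<longlongrightarrow> (\<tau> \<theta>, \<theta>)) (at \<theta>)"
    using cont by (intro tendsto_Pair tendsto_ident_at) (simp add: isCont_def)
  \<comment> \<open>The second components differ even where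
    \<open>\<tau> \<eta> = \<tau> \<theta>\<close>, so the curve lies in the punctured filter in
    which the expansion of \<open>G\<close> is stated.\<close>
  moreover have "\<forall>\<^sub>F \<eta> in at \<theta>. (\<tau> \<eta>, \<eta>) \<noteq> (\<tau> \<theta>, \<theta>)"
    by (auto simp: eventually_at_filter)
  ultimately have lim: "filterlim (\<lambda>\<eta>. (\<tau> \<eta>, \<eta>)) (at (\<tau> \<theta>, \<theta>)) (at \<theta>)"
    by (rule filterlim_atI)
  show ?thesis
    unfolding has_derivative_within_alt2 c_def[symmetric] A_def[symmetric]
  proof (intro conjI allI impI)
    show "bounded_linear (\<lambda>h. - (A h / c))"
      using bounded_linear_minus[OF bounded_linear_divide[THEN bounded_linear_compose, OF blA]]
      by simp
  next
    fix e :: real assume e: "e > 0"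
    \<comment> \<open>The first bound serves the absorption that yields \<open>M\<close>; the second
      makes \<open>d (M + 1)\<close> at most \<open>e |c|\<close>, the error allowed before dividing
      by \<open>|c|\<close>.\<close>
    define d where "d = min (\<bar>c\<bar> / 2) (e * \<bar>c\<bar> / (M + 1))"
    have d: "d > 0" "d \<le> \<bar>c\<bar> / 2" "d \<le> e * \<bar>c\<bar> / (M + 1)"
    proof -
      show "d > 0" unfolding d_def using c e M by simp
    qed (unfold d_def, rule min.cobounded1, rule min.cobounded2)
    from d(3) have dM: "d * (M + 1) \<le> e * \<bar>c\<bar>"
      using M by (simp add: pos_le_divide_eq)
    have "\<forall>\<^sub>F z in at (\<tau> \<theta>, \<theta>).
        norm (G z - G (\<tau> \<theta>, \<theta>) - G' (z - (\<tau> \<theta>, \<theta>))) \<le> d * norm (z - (\<tau> \<theta>, \<theta>))"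
      using G d(1) unfolding has_derivative_within_alt2 by blast
    from filterlim_iff[THEN iffD1, OF lim, rule_format, OF this] zero_near
    show "\<forall>\<^sub>F \<eta> in at \<theta>.
        norm (\<tau> \<eta> - \<tau> \<theta> - - (A (\<eta> - \<theta>) / c)) \<le> e * norm (\<eta> - \<theta>)"
    proof eventually_elim
      case (elim \<eta>)
      let ?a = "\<tau> \<eta> - \<tau> \<theta>" and ?h = "\<eta> - \<theta>"
      have "\<bar>?a * c + A ?h\<bar> \<le> d * norm (?a, ?h)"
        using elim zero_at by (simp add: split)
      also have "\<dots> \<le> d * (\<bar>?a\<bar> + norm ?h)"
        using d(1) norm_Pair_le[of ?a ?h] by (intro mult_left_mono) auto
      finally have rem: "\<bar>?a * c + A ?h\<bar> \<le> d * (\<bar>?a\<bar> + norm ?h)" .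
      have "d * (\<bar>?a\<bar> + norm ?h) \<le> \<bar>c\<bar> / 2 * (\<bar>?a\<bar> + norm ?h)"
        using d(2) by (intro mult_right_mono) auto
      moreover have "\<bar>?a\<bar> * \<bar>c\<bar> \<le> \<bar>?a * c + A ?h\<bar> + \<bar>A ?h\<bar>"
        unfolding abs_mult[symmetric] by linarith
      ultimately have "\<bar>?a\<bar> * \<bar>c\<bar> \<le> \<bar>c\<bar> / 2 * (\<bar>?a\<bar> + norm ?h) + K * norm ?h"
        using rem K(2)[of ?h] by linarith
      then have lip: "\<bar>?a\<bar> \<le> M * norm ?h"
        using c by (simp add: M_def field_simps)
      have "\<bar>?a * c + A ?h\<bar> \<le> d * ((M + 1) * norm ?h)"
        using lip d(1) by (intro order_trans[OF rem] mult_left_mono) (auto simp: algebra_simps)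
      also have "\<dots> \<le> e * \<bar>c\<bar> * norm ?h"
        using mult_right_mono[OF dM norm_ge_zero[of ?h]] by (simp add: mult.assoc)
      finally have "\<bar>?a * c + A ?h\<bar> / \<bar>c\<bar> \<le> e * norm ?h"
        using c by (simp add: field_simps)
      moreover have "?a - - (A ?h / c) = (?a * c + A ?h) / c"
        using c by (simp add: field_simps)
      ultimately show ?case by (simp only: real_norm_def abs_divide)
    qed
  qed
qed

text \<open>A linear functional is determined by its values on the standard basis. This passes
  between rows of partial derivatives and derivative maps; differentiability ensures that
  \<open>frechet_derivative\<close> is the actual derivative.\<close>

lemma row_deriv_inner:
  assumes "(h has_derivative h') (at u)"
  shows "row_deriv h u \<bullet> v = h' v"
proof -
  interpret bounded_linear h' using assms by (rule has_derivative_bounded_linear)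
  have "h' v = h' (\<Sum>i\<in>UNIV. v $ i *\<^sub>R axis i 1)"
    by (simp only: basis_expansion flip: scalar_mult_eq_scaleR)
  also have "\<dots> = (\<Sum>i\<in>UNIV. v $ i * h' (axis i 1))"
    by (simp add: sum scaleR)
  finally show ?thesis
    by (simp add: row_deriv_def frechet_derivative_at[OF assms, symmetric] inner_vec_def mult.commute)
qed

text \<open>The entries are coordinates of images of basis vectors, so pointwise convergence of the
  maps suffices.\<close>

lemma matrix_tendsto:
  fixes L :: "'b \<Rightarrow> real^'p \<Rightarrow> real^'n"
  assumes "\<And>h. ((\<lambda>t. L t h) \<longlongrightarrow> L' h) F"
  shows "((\<lambda>t. matrix (L t)) \<longlongrightarrow> matrix L') F"
  unfolding matrix_def by (intro vec_tendstoI) (simp add: tendsto_vec_nth assms)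

lemma before_eq:
  assumes "(h \<longlongrightarrow> l) (at_left t)"
  shows "before h t = l"
  unfolding before_def by (rule tendsto_Lim[OF _ assms]) simp

text \<open>As \<open>s \<eta> < \<tau> \<eta>\<close>, the two curves agree on a left neighbourhood
  of the event, and \<open>\<phi>\<close> is continuous there because it solves the differential
  equation. A reset of \<open>x\<close> at the event therefore does no harm.\<close>

lemma before_trajectory:
  assumes traj: "mode_trajectory f x s \<tau> U"
    and flow: "continued_flow f x s \<tau> U \<phi> N"
    and "open N" "\<eta> \<in> U" "(\<tau> \<eta>, \<eta>) \<in> N"
  shows "before (\<lambda>t. x t \<eta>) (\<tau> \<eta>) = \<phi> (\<tau> \<eta>) \<eta>"
proof (rule before_eq)
  have "((\<lambda>t. (t, \<eta>)) \<longlongrightarrow> (\<tau> \<eta>, \<eta>)) (at_left (\<tau> \<eta>))"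
    by (intro tendsto_intros)
  then have inN: "\<forall>\<^sub>F t in at_left (\<tau> \<eta>). (t, \<eta>) \<in> N"
    using assms(3,5) by (rule topological_tendstoD)
  have "s \<eta> < \<tau> \<eta>" using traj \<open>\<eta> \<in> U\<close> by (auto simp: mode_trajectory_def)
  then have "\<forall>\<^sub>F t in at_left (\<tau> \<eta>). t \<in> {s \<eta><..<\<tau> \<eta>}"
    by (intro eventually_at_leftI[of "s \<eta>"])
  with inN have ev: "\<forall>\<^sub>F t in at_left (\<tau> \<eta>). \<phi> t \<eta> = x t \<eta>"
    by eventually_elim (use flow \<open>\<eta> \<in> U\<close> in \<open>auto simp: continued_flow_def\<close>)
  have "((\<lambda>r. \<phi> r \<eta>) has_vector_derivative f (\<phi> (\<tau> \<eta>) \<eta>) \<eta>) (at (\<tau> \<eta>))"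
    using flow assms(5) by (auto simp: continued_flow_def)
  then have "((\<lambda>t. \<phi> t \<eta>) \<longlongrightarrow> \<phi> (\<tau> \<eta>) \<eta>) (at_left (\<tau> \<eta>))"
    using has_vector_derivative_continuous continuous_at_imp_continuous_at_within
    unfolding continuous_within by blast
  then show "((\<lambda>t. x t \<eta>) \<longlongrightarrow> \<phi> (\<tau> \<eta>) \<eta>) (at_left (\<tau> \<eta>))"
    using tendsto_cong[OF ev] by blast
qed

text \<open>At fixed time the parameter derivative is the joint derivative restricted to directions
  \<open>(0, h)\<close>. Continuity of \<open>F'\<close> lets this pass to the left limit.\<close>

lemma before_sensitivity:
  fixes \<phi> :: "real \<Rightarrow> real^'p \<Rightarrow> real^'n"
  assumes deriv: "\<And>z. z \<in> N \<Longrightarrow> ((\<lambda>(t, \<eta>). \<phi> t \<eta>) has_derivative blinfun_apply (F' z)) (at z)"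
    and cont: "continuous_on N F'"
    and N: "open N" "(t0, \<theta>) \<in> N"
  shows "before (sensitivity \<phi> \<theta>) t0 = matrix (\<lambda>h. F' (t0, \<theta>) (0, h))"
proof (rule before_eq)
  have lim: "((\<lambda>t. (t, \<theta>)) \<longlongrightarrow> (t0, \<theta>)) (at_left t0)"
    by (intro tendsto_intros)
  have inN: "\<forall>\<^sub>F t in at_left t0. (t, \<theta>) \<in> N"
    using topological_tendstoD[OF lim] N by blast
  have sens: "sensitivity \<phi> \<theta> t = matrix (\<lambda>h. F' (t, \<theta>) (0, h))" if "(t, \<theta>) \<in> N" for t
  proof -
    have "((\<lambda>\<eta>. (t, \<eta>)) has_derivative (\<lambda>h. (0, h))) (at \<theta>)"
      by (intro derivative_intros)
    from has_derivative_compose[OF this deriv[OF that]]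
    have "(\<phi> t has_derivative (\<lambda>h. F' (t, \<theta>) (0, h))) (at \<theta>)" by simp
    from frechet_derivative_at[OF this] show ?thesis
      by (simp add: sensitivity_def jacobian_def)
  qed
  have "isCont F' (t0, \<theta>)" using cont N continuous_on_eq_continuous_at by blast
  then have "((\<lambda>t. F' (t, \<theta>)) \<longlongrightarrow> F' (t0, \<theta>)) (at_left t0)"
    using isCont_tendsto_compose lim by blast
  then have "((\<lambda>t. matrix (\<lambda>h. F' (t, \<theta>) (0, h))) \<longlongrightarrow> matrix (\<lambda>h. F' (t0, \<theta>) (0, h))) (at_left t0)"
    \<comment> \<open>Convergence in operator norm gives convergence of the values at each fixed
      \<open>h\<close>.\<close>
    by (intro matrix_tendsto tendsto_intros)
  then show "(sensitivity \<phi> \<theta> \<longlongrightarrow> matrix (\<lambda>h. F' (t0, \<theta>) (0, h))) (at_left t0)"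
    by (rule Lim_transform_eventually) (use inN in \<open>eventually_elim, simp add: sens\<close>)
qed

text \<open>The direction \<open>(v, h, a)\<close> is a sum of three directions along the factors;
  composing \<open>g\<close> with the embedding of each factor identifies the corresponding partial
  derivative.\<close>

lemma has_derivative_partials:
  fixes g :: "real^'n \<Rightarrow> real^'p \<Rightarrow> real \<Rightarrow> real"
  assumes g: "((\<lambda>(y, \<eta>, t). g y \<eta> t) has_derivative g') (at (y, \<eta>, t))"
  shows "g' (v, h, a) = D_x g y \<eta> t \<bullet> v + D_theta g y \<eta> t \<bullet> h + a * D_t g y \<eta> t"
proof -
  interpret bounded_linear g' using g by (rule has_derivative_bounded_linear)
  have "((\<lambda>u. (u, \<eta>, t)) has_derivative (\<lambda>v. (v, 0, 0))) (at y)"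
    by (intro derivative_intros)
  from has_derivative_compose[OF this g]
  have x: "D_x g y \<eta> t \<bullet> v = g' (v, 0, 0)" unfolding D_x_def by (intro row_deriv_inner) simp
  have "((\<lambda>u. (y, u, t)) has_derivative (\<lambda>v. (0, v, 0))) (at \<eta>)"
    by (intro derivative_intros)
  from has_derivative_compose[OF this g]
  have theta: "D_theta g y \<eta> t \<bullet> h = g' (0, h, 0)"
    unfolding D_theta_def by (intro row_deriv_inner) simp
  have lin: "g' (0, 0, a) = a * g' (0, 0, 1)" for a
    using scaleR[of a "(0, 0, 1)"] by simp
  have "((\<lambda>u. (y, \<eta>, u)) has_derivative (\<lambda>v. (0, 0, v))) (at t)"
    by (intro derivative_intros)
  from has_derivative_compose[OF this g]
  have "((\<lambda>u. g y \<eta> u) has_derivative (\<lambda>a. g' (0, 0, a))) (at t)" by simp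
  moreover have "(\<lambda>a. g' (0, 0, a)) = (*) (g' (0, 0, 1))"
    by (rule ext, subst lin) simp
  ultimately have "D_t g y \<eta> t = g' (0, 0, 1)"
    unfolding D_t_def by (intro DERIV_imp_deriv) (simp add: has_field_derivative_def)
  then have "a * D_t g y \<eta> t = g' (0, 0, a)" using lin[of a] by simp
  with x theta show ?thesis
    using add[of "(v, 0, 0)" "(0, h, a)"] add[of "(0, h, 0)" "(0, 0, a)"] by simp
qed

text \<open>The flow \<open>\<phi>\<close> models the continuation in mode q slightly past the
  event, while the pre-event state and sensitivity are left limits. Differentiability of
  \<open>\<tau>\<close> belongs to the conclusion because an equation for \<open>row_deriv\<close>
  alone would not assert it.\<close>

theorem mainTheorem3:
  fixes f :: "real^'n \<Rightarrow> real^'p \<Rightarrow> real^'n"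
    and g :: "real^'n \<Rightarrow> real^'p \<Rightarrow> real \<Rightarrow> real"
    and x \<phi> :: "real \<Rightarrow> real^'p \<Rightarrow> real^'n"
    and s \<tau> :: "real^'p \<Rightarrow> real"
    and U :: "(real^'p) set"
    and N :: "(real \<times> (real^'p)) set"
    and \<theta> :: "real^'p"
  assumes f_C1: "cont_diff_on (\<lambda>(y, \<eta>). f y \<eta>) UNIV"
    and g_C1: "cont_diff_on (\<lambda>(y, \<eta>, t). g y \<eta> t) UNIV"
    and U: "open U" "\<theta> \<in> U"
    and traj: "mode_trajectory f x s \<tau> U"
    and N: "open N" "(\<tau> \<theta>, \<theta>) \<in> N"
    and flow: "continued_flow f x s \<tau> U \<phi> N"
    and flow_C1: "cont_diff_on (\<lambda>(t, \<eta>). \<phi> t \<eta>) N"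
    and tau_cont: "continuous_on U \<tau>"
    and guard: "\<And>\<eta>. \<eta> \<in> U \<Longrightarrow> g (before (\<lambda>t. x t \<eta>) (\<tau> \<eta>)) \<eta> (\<tau> \<eta>) = 0"
    and transversal:
      "let xm = before (\<lambda>t. x t \<theta>) (\<tau> \<theta>)
       in D_t g xm \<theta> (\<tau> \<theta>) + D_x g xm \<theta> (\<tau> \<theta>) \<bullet> f xm \<theta> \<noteq> 0"
  shows "\<tau> differentiable (at \<theta>) \<and>
    (let xm = before (\<lambda>t. x t \<theta>) (\<tau> \<theta>);
         Zm = before (sensitivity \<phi> \<theta>) (\<tau> \<theta>)
     in row_deriv \<tau> \<theta> =
        - ((D_x g xm \<theta> (\<tau> \<theta>) v* Zm + D_theta g xm \<theta> (\<tau> \<theta>))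
            /\<^sub>R (D_t g xm \<theta> (\<tau> \<theta>) + D_x g xm \<theta> (\<tau> \<theta>) \<bullet> f xm \<theta>)))"
proof -
  define t0 where "t0 = \<tau> \<theta>"
  define x0 where "x0 = \<phi> t0 \<theta>"
  obtain g' where g': "\<And>z. ((\<lambda>(y, \<eta>, t). g y \<eta> t) has_derivative blinfun_apply (g' z)) (at z)"
    using g_C1 unfolding cont_diff_on_def by blast
  obtain \<phi>' where
    \<phi>': "\<And>z. z \<in> N \<Longrightarrow> ((\<lambda>(t, \<eta>). \<phi> t \<eta>) has_derivative blinfun_apply (\<phi>' z)) (at z)"
    and \<phi>'_cont: "continuous_on N \<phi>'"
    using flow_C1 unfolding cont_diff_on_def by blast
  have N0: "(t0, \<theta>) \<in> N" using N by (simp add: t0_def)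
  have xm: "before (\<lambda>t. x t \<theta>) (\<tau> \<theta>) = x0"
    unfolding x0_def t0_def by (rule before_trajectory[OF traj flow N(1) U(2) N(2)])
  define Z where "Z = before (sensitivity \<phi> \<theta>) (\<tau> \<theta>)"
  have Z: "Z = matrix (\<lambda>h. \<phi>' (t0, \<theta>) (0, h))"
    unfolding Z_def t0_def by (rule before_sensitivity[OF \<phi>' \<phi>'_cont N])
  have "bounded_linear (\<lambda>h::real^'p. (0::real, h))"
    by (intro bounded_linear_Pair bounded_linear_zero bounded_linear_ident)
  \<comment> \<open>Only for a linear map does multiplication by its matrix recover the map.\<close>
  then have "linear (\<lambda>h. \<phi>' (t0, \<theta>) (0, h))"
    by (intro bounded_linear.linear bounded_linear_compose[OF blinfun.bounded_linear_right])
  then have Zh: "Z *v h = \<phi>' (t0, \<theta>) (0, h)" for h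
    by (simp add: Z matrix_works)
  \<comment> \<open>The time derivative of \<open>\<phi>\<close> at the event is read off twice,
    from the joint derivative and from the differential equation, and derivatives are
    unique.\<close>
  have velocity: "\<phi>' (t0, \<theta>) (1, 0) = f x0 \<theta>"
  proof -
    have "((\<lambda>r. (r, \<theta>)) has_derivative (\<lambda>a. (a, 0))) (at t0)"
      by (intro derivative_intros)
    from has_derivative_compose[OF this \<phi>'[OF N0]]
    have "((\<lambda>r. \<phi> r \<theta>) has_derivative (\<lambda>a. \<phi>' (t0, \<theta>) (a, 0))) (at t0)" by simp
    moreover have "((\<lambda>r. \<phi> r \<theta>) has_derivative (\<lambda>a. a *\<^sub>R f x0 \<theta>)) (at t0)"
      using flow N0 unfolding continued_flow_def x0_def has_vector_derivative_def by auto
    ultimately have "(\<lambda>a. \<phi>' (t0, \<theta>) (a, 0)) = (\<lambda>a. a *\<^sub>R f x0 \<theta>)"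
      by (rule has_derivative_unique)
    from fun_cong[OF this, of 1] show ?thesis by simp
  qed

  \<comment> \<open>\<open>G\<close> takes time first, whereas \<open>g\<close> takes it last; hence
    the swapped \<open>snd z, fst z\<close> in the chain rule derivative \<open>G'\<close>.\<close>
  define G where "G = (\<lambda>(t, \<eta>). g (\<phi> t \<eta>) \<eta> t)"
  define G' where "G' = (\<lambda>z. g' (x0, \<theta>, t0) (\<phi>' (t0, \<theta>) z, snd z, fst z))"
  define c where "c = D_t g x0 \<theta> t0 + D_x g x0 \<theta> t0 \<bullet> f x0 \<theta>"
  define r where "r = D_x g x0 \<theta> t0 v* Z + D_theta g x0 \<theta> t0"
  have c: "c \<noteq> 0"
    using transversal by (simp add: Let_def xm c_def t0_def)
  have "((\<lambda>z. ((\<lambda>(t, \<eta>). \<phi> t \<eta>) z, snd z, fst z)) has_derivative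
      (\<lambda>z. (\<phi>' (t0, \<theta>) z, snd z, fst z))) (at (t0, \<theta>))"
    by (intro has_derivative_Pair \<phi>'[OF N0] has_derivative_fst has_derivative_snd has_derivative_ident)
  from has_derivative_compose[OF this, of "\<lambda>(y, \<eta>, t). g y \<eta> t"] g'[of "(x0, \<theta>, t0)"]
  have G_deriv: "(G has_derivative G') (at (\<tau> \<theta>, \<theta>))"
    by (simp add: G_def G'_def x0_def t0_def case_prod_unfold)
  have G'_t: "G' (1, 0) = c"
    by (simp add: G'_def has_derivative_partials[OF g'] velocity c_def)
  \<comment> \<open>The time increment is zero, so \<open>D_t\<close> drops out;
    \<open>dot_lmul_matrix\<close> moves \<open>Z\<close> from the column \<open>h\<close> to the
    row \<open>D_x\<close>.\<close>
  have G'_\<theta>: "G' (0, h) = r \<bullet> h" for h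
    by (simp add: G'_def has_derivative_partials[OF g'] r_def inner_add_left
        dot_lmul_matrix flip: Zh)
  have \<tau>_cont: "isCont \<tau> \<theta>"
    using tau_cont U continuous_on_eq_continuous_at by blast
  have "isCont (\<lambda>\<eta>. (\<tau> \<eta>, \<eta>)) \<theta>"
    using \<tau>_cont by (intro continuous_intros)
  \<comment> \<open>Full neighbourhoods are used because \<open>G\<close> has to vanish at the base
    point as well as near it.\<close>
  then have "((\<lambda>\<eta>. (\<tau> \<eta>, \<eta>)) \<longlongrightarrow> (\<tau> \<theta>, \<theta>)) (nhds \<theta>)"
    unfolding isCont_def by (rule tendsto_at_iff_tendsto_nhds[THEN iffD1])
  then have "\<forall>\<^sub>F \<eta> in nhds \<theta>. (\<tau> \<eta>, \<eta>) \<in> N"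
    using N by (rule topological_tendstoD)
  moreover have "\<forall>\<^sub>F \<eta> in nhds \<theta>. \<eta> \<in> U"
    using U by (rule eventually_nhds_in_open)
  \<comment> \<open>Each nearby \<open>\<eta>\<close> has its own event point in \<open>N\<close>,
    so the guard on the left limit of \<open>x\<close> becomes a statement about
    \<open>\<phi>\<close>.\<close>
  ultimately have "\<forall>\<^sub>F \<eta> in nhds \<theta>. G (\<tau> \<eta>, \<eta>) = 0"
  proof eventually_elim
    case (elim \<eta>)
    then show ?case
      using guard[of \<eta>] before_trajectory[OF traj flow N(1), of \<eta>] by (simp add: G_def)
  qed
  with G_deriv \<tau>_cont c
  have \<tau>_deriv: "(\<tau> has_derivative (\<lambda>h. - (r \<bullet> h / c))) (at \<theta>)"
    using has_derivative_implicit_scalar[of G G' \<tau> \<theta>] by (simp add: G'_t G'_\<theta>)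
  \<comment> \<open>Rows are identified by their inner products with all vectors.\<close>
  have "row_deriv \<tau> \<theta> \<bullet> v = (- (r /\<^sub>R c)) \<bullet> v" for v
    by (simp add: row_deriv_inner[OF \<tau>_deriv] divide_inverse mult.commute)
  then have "row_deriv \<tau> \<theta> = - (r /\<^sub>R c)"
    by (metis vector_eq_rdot)
  moreover have "\<tau> differentiable (at \<theta>)"
    using \<tau>_deriv by (rule differentiableI)
  ultimately show ?thesis
    unfolding Let_def xm Z_def[symmetric] r_def c_def t0_def by blast
qed

end
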